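(* Let $q$ be an odd prime power, $r$ a positive integer and $c,u\in\mathbb{F}_{q}$. Then $$f(x)=(x^{q}+x+c)^{r}+ux^{q}-ux$$ is a permutation polynomial of $\mathbb{F}_{q^2}$ if and only if $u\neq 0$ and $\gcd(r,q-1)=1$.
   Context: A polynomial is a permutation polynomial of $\mathbb{F}_{q^2}$ if the map it induces on $\mathbb{F}_{q^2}$ is a bijection. $\mathbb{F}_q$ is regarded as a subfield of $\mathbb{F}_{q^2}$. *)

theory Defs
  imports "HOL-Computational_Algebra.Computational_Algebra" "HOL-Number_Theory.Prime_Powers"
    "HOL-Library.Cardinality"
begin

definition is_subfield :: "'a::field set \<Rightarrow> bool" where
  "is_subfield K \<longleftrightarrow> 0 \<in> K \<and> 1 \<in> K
     \<and> (\<forall>x\<in>K. \<forall>y\<in>K. x + y \<in> K \<and> x * y \<in> K)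
     \<and> (\<forall>x\<in>K. - x \<in> K \<and> inverse x \<in> K)"

definition permutation_poly :: "'a::finite_field poly \<Rightarrow> bool" where
  "permutation_poly f \<longleftrightarrow> bij (poly f)"

definition trace_poly :: "nat \<Rightarrow> nat \<Rightarrow> 'a::field \<Rightarrow> 'a \<Rightarrow> 'a poly" where
  "trace_poly q r c u =
     (monom 1 q + [:0, 1:] + [:c:]) ^ r + smult u (monom 1 q) - smult u [:0, 1:]"

lemma poly_trace_poly:
  "poly (trace_poly q r c u) x = (x ^ q + x + c) ^ r + u * x ^ q - u * x"
  by (simp add: trace_poly_def poly_monom add.commute)

end

theory Submission
  imports Defs "HOL-Number_Theory.Residues"
begin

text \<open>
  Since \<open>q\<close> is odd, every element of the field is determined by its trace \<open>x\<^sup>q + x\<close>, which lies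
  in \<open>K\<close>, and by \<open>x\<^sup>q - x\<close>, which is negated by the Frobenius map \<open>x \<mapsto> x\<^sup>q\<close>. The two summands
  of \<open>f\<close> lie in the corresponding eigenspaces, so \<open>f x = f y\<close> separates into an equation for each.
  Conversely, on \<open>K\<close> the map \<open>f\<close> is \<open>z \<mapsto> (2 z + c)\<^sup>r\<close>, and for \<open>u = 0\<close> it cannot distinguish
  \<open>x\<close> from \<open>x\<^sup>q\<close>.
\<close>

text \<open>Multiplication by a nonzero \<open>z\<close> permutes \<open>K - {0}\<close>. Comparing
  the product of all nonzero elements before and after, and cancelling it, leaves
  \<open>z ^ (card K - 1) = 1\<close>.\<close>

lemma subfield_power_card_eq_same:
  fixes K :: "'a::finite_field set"
  assumes "is_subfield K" and "z \<in> K"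
  shows "z ^ card K = z"
proof (cases "z = 0")
  case True
  then show ?thesis
    using assms by (auto simp: power_0_left card_eq_0_iff)
next
  case False
  have "bij_betw ((*) z) (K - {0}) (K - {0})"
    by (rule bij_betwI[of _ _ _ "(*) (inverse z)"])
       (use assms False in \<open>auto simp: is_subfield_def field_simps\<close>)
  then have "(\<Prod>w\<in>K - {0}. z * w) = (\<Prod>w\<in>K - {0}. w)"
    by (rule prod.reindex_bij_betw)
  then have "z ^ card (K - {0}) * \<Prod>(K - {0}) = 1 * \<Prod>(K - {0})"
    by (simp add: prod.distrib)
  then have "z ^ card (K - {0}) = 1"
    unfolding mult_cancel_right by simp
  moreover have "card K = Suc (card (K - {0}))"
    using assms by (intro card.remove) (auto simp: is_subfield_def)
  ultimately show ?thesis
    by simp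
qed

text \<open>These are the roots of X^n - X. For \<open>n > 1\<close> the leading term survives, so
  the polynomial is nonzero of degree \<open>n\<close>.\<close>

lemma card_power_eq_same_le:
  assumes "n > 1"
  shows "card {z::'a::idom. z ^ n = z} \<le> n"
proof -
  have *: "degree (Polynomial.monom 1 n + [:0, -1:] :: 'a poly) = n"
    using assms by (subst degree_add_eq_left) (auto simp: degree_monom_eq)
  then have "(Polynomial.monom 1 n + [:0, -1:] :: 'a poly) \<noteq> 0"
    using assms by auto
  with card_poly_roots_bound[OF this] * show ?thesis
    by (simp add: poly_monom)
qed

lemma card_subfield_gt_1:
  fixes K :: "'a::finite_field set"
  assumes "is_subfield K"
  shows "card K > 1"
proof -
  have "card {0, 1 :: 'a} \<le> card K"
    using assms by (intro card_mono) (auto simp: is_subfield_def)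
  then show ?thesis
    by simp
qed

text \<open>X^|K| - X already has all of \<open>K\<close> as roots and its degree leaves room for no
  others. This turns membership in \<open>K\<close> into an equation that can be checked by
  computing a power.\<close>

lemma subfield_eq_fixed_points:
  fixes K :: "'a::finite_field set"
  assumes "is_subfield K"
  shows "K = {z. z ^ card K = z}"
  using subfield_power_card_eq_same[OF assms]
    card_power_eq_same_le[OF card_subfield_gt_1[OF assms]]
  by (intro card_seteq) auto

text \<open>A common divisor d > 1 of \<open>r\<close> and |K| - 1 would force all nonzero elements
  to satisfy z^m = 1 with m = (|K| - 1)/d, too many roots. In the coprime case an inverse of
  \<open>r\<close> modulo |K| - 1 provides an exponent that undoes the power map.\<close>

lemma inj_on_power_subfield_iff:
  fixes K :: "'a::finite_field set"
  assumes K: "is_subfield K" and "r > 0"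
  shows "inj_on (\<lambda>z. z ^ r) K \<longleftrightarrow> gcd r (card K - 1) = 1"
proof -
  note gt = card_subfield_gt_1[OF K]
  have one: "z ^ (card K - 1) = 1" if "z \<in> K" "z \<noteq> 0" for z
  proof -
    have "z * z ^ (card K - 1) = z * 1"
      using subfield_power_card_eq_same[OF K that(1)] gt by (simp flip: power_Suc)
    with that show ?thesis
      by (simp only: mult_cancel_left) auto
  qed
  have closed: "z ^ n \<in> K" if "z \<in> K" for z n
    using that K by (induction n) (auto simp: is_subfield_def)
  show ?thesis
  proof
    assume inj: "inj_on (\<lambda>z. z ^ r) K"
    define d where "d = gcd r (card K - 1)"
    obtain s m where s: "r = d * s" and m: "card K - 1 = d * m"
      unfolding d_def by (meson dvdE gcd_dvd1 gcd_dvd2)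
    from m gt have "m > 0" by (cases m) auto
    \<comment> \<open>The exponent \<open>Suc m\<close> instead of \<open>m\<close> lets 0 be
      counted too, so the root bound reads d m + 1 \<le> m + 1.\<close>
    have "K \<subseteq> {z. z ^ Suc m = z}"
    proof safe
      fix z assume z: "z \<in> K"
      show "z ^ Suc m = z"
      proof (cases "z = 0")
        case False
        have "(z ^ m) ^ r = (z ^ (card K - 1)) ^ s"
          unfolding m s by (simp add: mult_ac flip: power_mult)
        also have "\<dots> = 1 ^ r"
          using one[OF z False] by simp
        finally have "z ^ m = 1"
          using inj_onD[OF inj] closed[OF z] K by (auto simp: is_subfield_def)
        then show ?thesis by simp
      qed auto
    qed
    then have "card K \<le> card {z::'a. z ^ Suc m = z}"
      by (intro card_mono) auto
    also have "\<dots> \<le> Suc m"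
      using \<open>m > 0\<close> by (intro card_power_eq_same_le) auto
    finally have "d * m \<le> 1 * m"
      using m by linarith
    with \<open>m > 0\<close> have "d \<le> 1"
      by (simp only: mult_le_cancel2)
    moreover have "d > 0"
      using \<open>r > 0\<close> by (simp add: d_def)
    ultimately show "gcd r (card K - 1) = 1"
      unfolding d_def by linarith
  next
    assume "gcd r (card K - 1) = 1"
    then have "coprime r (card K - 1)"
      by (simp add: coprime_iff_gcd_eq_1)
    then obtain t0 where "[r * t0 = 1] (mod (card K - 1))"
      using cong_solve_coprime_nat by auto
    \<comment> \<open>The shift makes the exponent positive: \<open>0 ^ t\<close> must be 0, and for
      |K| = 2 the modulus is 1, so \<open>t0\<close> could be 0.\<close>
    moreover define t where "t = t0 + (card K - 1)"
    ultimately have "[r * t = 1] (mod (card K - 1))"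
      by (simp add: cong_def distrib_left)
    moreover have "t > 0"
      using gt by (simp add: t_def)
    ultimately obtain k where k: "r * t = 1 + k * (card K - 1)"
      using \<open>r > 0\<close> unfolding cong_to_1'_nat by auto
    have "(z ^ r) ^ t = z" if "z \<in> K" for z
    proof (cases "z = 0")
      case True
      then show ?thesis
        using \<open>r > 0\<close> \<open>t > 0\<close> by simp
    next
      case False
      have "(z ^ r) ^ t = z * (z ^ (card K - 1)) ^ k"
        using k by (simp add: mult_ac flip: power_mult)
      with one[OF that False] show ?thesis by simp
    qed
    then show "inj_on (\<lambda>z. z ^ r) K"
      by (rule inj_on_inverseI)
  qed
qed

lemma CHAR_eq_if_CARD_eq_prime_power:
  assumes "prime p" and "CARD('a::finite_field) = p ^ n"
  shows "CHAR('a) = p"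
proof -
  have "CHAR('a) dvd p ^ n"
    using CHAR_dvd_CARD[where 'a = 'a] assms by simp
  moreover have "prime CHAR('a)"
    by simp
  ultimately show ?thesis
    using assms(1) prime_dvd_power primes_dvd_imp_eq by blast
qed

theorem corollary3:
  fixes q r :: nat and K :: "'a::finite_field set" and c u :: 'a
  assumes "primepow q" and "odd q" and "CARD('a) = q ^ 2"
    and "is_subfield K" and "card K = q"
    and "r > 0" and "c \<in> K" and "u \<in> K"
  shows "permutation_poly (trace_poly q r c u) \<longleftrightarrow> u \<noteq> 0 \<and> gcd r (q - 1) = 1"
proof -
  obtain p k where p: "prime p" "q = p ^ k" "k > 0"
    using \<open>primepow q\<close> by (auto simp: primepow_def)
  have char: "CHAR('a) = p"
    using p assms(3) by (intro CHAR_eq_if_CARD_eq_prime_power[of p "k * 2"]) (simp_all add: power_mult)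
  have add: "(x + y) ^ q = x ^ q + y ^ q" for x y :: 'a
    using freshmans_dream'[of "p ^ k" k x y] p char by simp
  have "(2 :: 'a) \<noteq> 0"
  proof
    assume "(2 :: 'a) = 0"
    then have "p dvd 2"
      using of_nat_eq_0_iff_char_dvd[of 2, where 'a = 'a] char by simp
    then have "p = 2"
      using p(1) primes_dvd_imp_eq two_is_prime_nat by blast
    with p \<open>odd q\<close> show False by simp
  qed
  have frob2: "(x ^ q) ^ q = x" for x :: 'a
    using finite_field_power_card_eq_same[of x] assms(3)
    by (simp add: power2_eq_square power_mult)
  have K_iff: "z \<in> K \<longleftrightarrow> z ^ q = z" for z
    using subfield_eq_fixed_points[OF assms(4)] assms(5) by blast
  have K_add: "x + y \<in> K" and K_mult: "x * y \<in> K" if "x \<in> K" "y \<in> K" for x y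
    using that \<open>is_subfield K\<close> by (auto simp: is_subfield_def)
  have K_uminus: "- x \<in> K" and K_inverse: "inverse x \<in> K" if "x \<in> K" for x
    using that \<open>is_subfield K\<close> by (auto simp: is_subfield_def)
  have K_power: "x ^ n \<in> K" if "x \<in> K" for x n
    using that K_mult \<open>is_subfield K\<close> by (induction n) (auto simp: is_subfield_def)
  \<comment> \<open>The map \<open>x \<mapsto> x ^ q\<close> swaps the first two summands and fixes
    \<open>c\<close>.\<close>
  have trace: "x ^ q + x + c \<in> K" for x
    using \<open>c \<in> K\<close> by (simp add: K_iff add frob2 add_ac)
  have "2 \<in> K"
    using K_add[of 1 1] \<open>is_subfield K\<close> by (simp add: is_subfield_def)
  have eval: "poly (trace_poly q r c u) x = (x ^ q + x + c) ^ r + u * (x ^ q - x)" for x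
    by (simp add: poly_trace_poly algebra_simps)
  have perm: "permutation_poly (trace_poly q r c u) \<longleftrightarrow> inj (poly (trace_poly q r c u))"
    unfolding permutation_poly_def bij_def
    using finite_UNIV_inj_surj[of "poly (trace_poly q r c u)"] by auto
  show ?thesis
    unfolding perm
  proof (intro iffI conjI)
    assume inj: "inj (poly (trace_poly q r c u))"
    show "u \<noteq> 0"
    proof
      assume "u = 0"
      have "x \<in> K" for x
      proof -
        have "poly (trace_poly q r c u) (x ^ q) = poly (trace_poly q r c u) x"
          unfolding eval using \<open>u = 0\<close> by (simp add: frob2 add_ac)
        with inj show ?thesis
          by (simp add: K_iff inj_eq)
      qed
      then have "K = UNIV" by auto
      then have "q ^ 2 = q" using assms by simp
      then show False
        using primepow_gt_Suc_0[OF \<open>primepow q\<close>] by (simp add: power2_eq_square)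
    qed
    have "inj_on (\<lambda>z. z ^ r) K"
    proof (rule inj_onI)
      fix a b assume ab: "a \<in> K" "b \<in> K" "a ^ r = b ^ r"
      \<comment> \<open>\<open>h\<close> inverts \<open>z \<mapsto> 2 * z + c\<close>. It maps
        \<open>K\<close> to \<open>K\<close>, where \<open>x ^ q - x\<close> vanishes, so
        \<open>r\<close>-th powers become values of the polynomial.\<close>
      define h where "h = (\<lambda>z. (z - c) / 2)"
      have h: "poly (trace_poly q r c u) (h z) = z ^ r" if "z \<in> K" for z
      proof -
        have "h z \<in> K"
          using that K_mult[OF K_add[OF that K_uminus[OF \<open>c \<in> K\<close>]] K_inverse[OF \<open>2 \<in> K\<close>]]
          unfolding h_def divide_inverse diff_conv_add_uminus by blast
        then have "h z ^ q = h z"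
          by (simp add: K_iff)
        then have "poly (trace_poly q r c u) (h z) = (2 * h z + c) ^ r"
          by (simp add: eval)
        also have "2 * h z = z - c"
          unfolding h_def times_divide_eq_right
          using \<open>(2 :: 'a) \<noteq> 0\<close> by (rule nonzero_mult_div_cancel_left)
        finally show ?thesis by simp
      qed
      have "h a = h b"
        using inj h ab by (metis injD)
      then show "a = b"
        using \<open>(2 :: 'a) \<noteq> 0\<close> by (simp add: h_def)
    qed
    then show "gcd r (q - 1) = 1"
      using inj_on_power_subfield_iff[OF assms(4,6)] assms(5) by simp
  next
    assume "u \<noteq> 0 \<and> gcd r (q - 1) = 1"
    then have "u \<noteq> 0" and inj: "inj_on (\<lambda>z. z ^ r) K"
      using inj_on_power_subfield_iff[OF assms(4,6)] assms(5) by simp_all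
    show "inj (poly (trace_poly q r c u))"
    proof (rule injI)
      fix x y
      define A where "A = (\<lambda>z. (z ^ q + z + c) ^ r)"
      define D where "D = (\<lambda>z::'a. z ^ q - z)"
      assume "poly (trace_poly q r c u) x = poly (trace_poly q r c u) y"
      then have eq: "A x + u * D x = A y + u * D y"
        by (simp add: eval A_def D_def)
      have AK: "A z \<in> K" for z
        unfolding A_def by (intro K_power trace)
      \<comment> \<open>Additivity is applied to \<open>D z + z = z ^ q\<close>.\<close>
      have D_frob: "D z ^ q = - D z" for z
        using add[of "D z" z] by (simp add: D_def frob2 algebra_simps)
      \<comment> \<open>The \<open>q\<close>-th power fixes \<open>A z\<close> and \<open>u\<close>
        but negates \<open>D z\<close>. Raising \<open>eq\<close> to it gives a second equation, and
        the sum of the two isolates \<open>A\<close>.\<close>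
      have conj: "(A z + u * D z) ^ q = A z - u * D z" for z
        using AK[of z] \<open>u \<in> K\<close> by (simp add: add power_mult_distrib D_frob K_iff)
      have eq': "A x - u * D x = A y - u * D y"
        unfolding conj[symmetric] eq ..
      have "2 * A x = (A x + u * D x) + (A x - u * D x)"
        by simp
      also have "\<dots> = 2 * A y"
        unfolding eq eq' by simp
      finally have "A x = A y"
        using \<open>(2 :: 'a) \<noteq> 0\<close> by simp
      with eq \<open>u \<noteq> 0\<close> have "D x = D y"
        by simp
      from \<open>A x = A y\<close> have "x ^ q + x + c = y ^ q + y + c"
        using inj_onD[OF inj] trace unfolding A_def by blast
      then have "x ^ q + x = y ^ q + y"
        by simp
      \<comment> \<open>The trace minus \<open>D\<close> is twice the element itself.\<close>
      then have "(x ^ q + x) - D x = (y ^ q + y) - D y"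
        using \<open>D x = D y\<close> by (simp only:)
      then have "2 * x = 2 * y"
        by (simp add: D_def)
      then show "x = y"
        using \<open>(2 :: 'a) \<noteq> 0\<close> by simp
    qed
  qed
qed

end
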